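(* The exponential generating function $f(z)=\sum_{n\ge 0}\alpha_n\frac{z^n}{n!}$ of the pseudo-factorials satisfies $$f(z)=2^{1/3}\,\operatorname{sm}\!\left(\frac{\pi_3}{6}-2^{1/3}z\right)$$ (an identity of analytic functions around $z=0$), where $\operatorname{sm}$ is the Dixonian elliptic function and $\pi_3=3\int_0^1\frac{dy}{(1-y^3)^{2/3}}$.
   Context: The pseudo-factorials $(\alpha_n)_{n\ge 0}$ are the integers defined by $\alpha_0=1$ and $\alpha_{n+1}=(-1)^{n+1}\sum_{k=0}^n\binom{n}{k}\alpha_k\alpha_{n-k}$ for $n\ge 0$. Since $|\alpha_n|\le n!$, the series $f(z)=\sum_{n\ge 0}\alpha_n z^n/n!$ is analytic at least in $|z|<1$. The Dixonian function $\operatorname{sm}$ is defined by $\int_0^{\operatorname{sm}(z)}\frac{dy}{(1-y^3)^{2/3}}=z$ near $z=0$, extended to a meromorphic (elliptic) function on $\mathbb{C}$; equivalently, $(\operatorname{sm},\operatorname{cm})$ is the solution of $\operatorname{sm}'=\operatorname{cm}^2$, $\operatorname{cm}'=-\operatorname{sm}^2$ with $\operatorname{sm}(0)=0$, $\operatorname{cm}(0)=1$. The constant is $\pi_3=3\int_0^1\frac{dy}{(1-y^3)^{2/3}}=\frac{\Gamma(1/3)^2}{\Gamma(2/3)}=\frac{\sqrt3}{2\pi}\Gamma(1/3)^3$. *)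

theory Defs
  imports "HOL-Complex_Analysis.Complex_Analysis"
begin

fun pseudo_factorial :: "nat \<Rightarrow> int" where
  "pseudo_factorial 0 = 1"
| "pseudo_factorial (Suc n) =
     (-1) ^ (n + 1) *
     (\<Sum>k\<le>n. int (n choose k) * pseudo_factorial k * pseudo_factorial (n - k))"

definition pi3 :: real where
  "pi3 = 3 * integral {0..1} (\<lambda>y. 1 / (1 - y ^ 3) powr (2 / 3))"

text \<open>
  The integral equation is only required near \<open>0\<close>, where \<open>1 - y ^ 3\<close> stays in the right
  half-plane and the principal branch of \<open>powr\<close> is holomorphic; analyticity at \<open>0\<close> and
  \<open>s 0 = 0\<close> select the local inverse of the integral. Requiring \<open>s\<close> to be nicely meromorphic
  fixes its values everywhere (with value \<open>0\<close> at poles), so that there is at most one such \<open>s\<close>.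
\<close>

definition is_dixon_sm :: "(complex \<Rightarrow> complex) \<Rightarrow> bool" where
  "is_dixon_sm s \<longleftrightarrow>
     s nicely_meromorphic_on UNIV \<and> s analytic_on {0} \<and> s 0 = 0 \<and>
     (\<forall>\<^sub>F z in nhds 0.
        contour_integral (linepath 0 (s z)) (\<lambda>y. 1 / (1 - y ^ 3) powr (2 / 3)) = z)"

definition dixon_sm :: "complex \<Rightarrow> complex" where
  "dixon_sm = (THE s. is_dixon_sm s)"

end

theory Submission
  imports Defs
begin

text \<open>
  The recurrence says that the generating function \<open>f\<close> satisfies \<open>f' (z) = - f (- z) ^ 2\<close>. Hence
  \<open>g (z) = f (- z)\<close> satisfies \<open>g' = f ^ 2\<close>, so \<open>f ^ 3 + g ^ 3\<close> has derivative zero and keeps its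
  value \<open>2\<close>. Put \<open>a = 2 powr (1 / 3)\<close> and \<open>u = f / a\<close>. Then \<open>1 - u ^ 3 = (g / a) ^ 3\<close>, and the integral
  \<open>F (w)\<close> of \<open>1 / (1 - y ^ 3) powr (2 / 3)\<close> from \<open>0\<close> to \<open>w\<close> changes along \<open>u\<close> at the constant rate
  \<open>- a\<close>; this gives \<open>F (u z) = F (1 / a) - a * z\<close> near \<open>0\<close> (\<open>dixon_int_pf_egf\<close>). Two facts about the
  function sm turn this into the claimed identity.

  The first is \<open>F (1 / a) = pi3 / 6\<close> (\<open>dixon_int_inverse_cbrt_2\<close>): the involution
  \<open>y \<mapsto> (1 - y ^ 3) powr (1 / 3)\<close> of the unit interval fixes \<open>1 / a\<close> and exchanges the two parts of the
  integral over \<open>{0..1}\<close> on either side of it, so that \<open>F (1 / a)\<close> is half of that integral.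

  The second is \<open>sm (F w) = w\<close> on the whole unit disc (\<open>dixon_sm_dixon_int\<close>), which rests on the existence
  of sm as a meromorphic function on the plane. Near \<open>0\<close>, sm is the local inverse of \<open>F\<close>. To
  continue it, the duplication formula \<open>dixon_int_duplication\<close> expresses \<open>sm (2 * z)\<close> rationally in
  \<open>sm z\<close> and \<open>sm' z\<close>, so that a solution that is meromorphic on a disc yields one on the disc of twice the
  radius (\<open>dixon_sm_on_double\<close>). By the identity theorem the solutions on these growing discs agree where they
  overlap and are unique, so they fit together to the function selected by \<open>dixon_sm\<close>. The identity
  theorem then also extends \<open>sm (F w) = w\<close> from a neighbourhood of \<open>0\<close> to the unit disc.
\<close>

section \<open>The Dixonian integral and its duplication formula\<close>

text \<open>
  On the curve \<open>x ^ 3 + y ^ 3 = 1\<close> this is the second coordinate near the point \<open>(0, 1)\<close>: if \<open>y = sm z\<close> with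
  \<open>z\<close> near \<open>0\<close>, it is \<open>cm z\<close>.
\<close>

definition dixon_root :: "complex \<Rightarrow> complex" where
  "dixon_root y = (1 - y ^ 3) powr (1 / 3)"

definition dixon_int :: "complex \<Rightarrow> complex" where
  "dixon_int w = contour_integral (linepath 0 w) (\<lambda>y. 1 / (1 - y ^ 3) powr (2 / 3))"

text \<open>
  This keeps \<open>1 - y ^ 3\<close> away from the branch cut of the principal power, which makes the integrand holomorphic on
  the whole unit disc.
\<close>

lemma one_minus_cube_not_nonpos:
  assumes "norm (y::complex) < 1"
  shows   "1 - y ^ 3 \<notin> \<real>\<^sub>\<le>\<^sub>0"
proof -
  have "Re (y ^ 3) \<le> norm (y ^ 3)"
    by (rule complex_Re_le_cmod)
  also have "\<dots> < 1"
    using assms by (simp add: norm_power power_less_one_iff)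
  finally show ?thesis
    by (auto simp: complex_nonpos_Reals_iff)
qed

lemma dixon_root_0 [simp]: "dixon_root 0 = 1"
  by (simp add: dixon_root_def)

lemma powr_two_thirds: "(x::complex) powr (2 / 3) = (x powr (1 / 3)) ^ 2"
  by (simp add: powr_def flip: exp_double)

lemma dixon_root_power3: "dixon_root y ^ 3 = 1 - y ^ 3"
  by (simp add: dixon_root_def powr_def flip: exp_of_nat_mult)

lemma dixon_root_nonzero:
  assumes "norm y < 1"
  shows   "dixon_root y \<noteq> 0"
  using one_minus_cube_not_nonpos[OF assms] by (auto simp: dixon_root_def)

lemma has_field_derivative_dixon_root:
  assumes "norm y < 1"
  shows   "(dixon_root has_field_derivative - (y ^ 2 / dixon_root y ^ 2)) (at y)"
proof -
  have nz: "1 - y ^ 3 \<noteq> 0"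
    using one_minus_cube_not_nonpos[OF assms] by auto
  have eq: "(1 - y ^ 3) powr (1 / 3 - 1) = 1 / dixon_root y ^ 2"
  proof -
    have "(1 - y ^ 3) powr (1 / 3 - 1) = dixon_root y / (1 - y ^ 3)"
      using nz by (simp only: powr_diff dixon_root_def) simp
    also have "\<dots> = dixon_root y / dixon_root y ^ 3"
      by (simp only: dixon_root_power3)
    also have "\<dots> = 1 / dixon_root y ^ 2"
      using dixon_root_nonzero[OF assms] by (simp add: field_simps eval_nat_numeral)
    finally show ?thesis .
  qed
  have "((\<lambda>y. (1 - y ^ 3) powr (1 / 3)) has_field_derivative
          (1 / 3 * (1 - y ^ 3) powr (1 / 3 - 1) * (- (3 * y ^ 2)))) (at y)"
  proof (rule DERIV_chain2[of "\<lambda>z. z powr (1 / 3)" _ "\<lambda>y. 1 - y ^ 3"])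
    show "((\<lambda>z. z powr (1 / 3)) has_field_derivative 1 / 3 * (1 - y ^ 3) powr (1 / 3 - 1)) (at (1 - y ^ 3))"
      by (rule has_field_derivative_powr[OF one_minus_cube_not_nonpos[OF assms]])
  qed (auto intro!: derivative_eq_intros)
  thus ?thesis
    unfolding eq by (simp add: dixon_root_def [abs_def])
qed

text \<open>
  The integrand is holomorphic on a disc and has a primitive there; the integral along a radius is the increment of that
  primitive.
\<close>

lemma has_field_derivative_dixon_int:
  assumes "norm w < 1"
  shows   "(dixon_int has_field_derivative 1 / dixon_root w ^ 2) (at w)"
proof -
  let ?f = "\<lambda>y::complex. 1 / (1 - y ^ 3) powr (2 / 3)"
  have f_eq: "?f y = 1 / dixon_root y ^ 2" for y
    by (simp add: powr_two_thirds dixon_root_def)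
  have "dixon_root holomorphic_on ball 0 1"
    using has_field_derivative_dixon_root unfolding holomorphic_on_open[OF open_ball] by fastforce
  hence "?f holomorphic_on ball 0 1"
    unfolding f_eq by (intro holomorphic_intros) (auto simp: dixon_root_nonzero)
  then obtain g where g: "\<And>x. x \<in> ball 0 1 \<Longrightarrow> (g has_field_derivative ?f x) (at x within ball 0 1)"
    using holomorphic_convex_primitive'[of "ball 0 1" ?f] by auto
  have "dixon_int x = g x - g 0" if "x \<in> ball 0 1" for x
  proof -
    have "path_image (linepath 0 x) \<subseteq> ball 0 1"
      using that convex_ball[of 0 1] by (simp add: closed_segment_subset)
    hence "(?f has_contour_integral (g x - g 0)) (linepath 0 x)"
      using contour_integral_primitive[of "ball 0 1" g ?f "linepath 0 x"] g by simp
    thus ?thesis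
      unfolding dixon_int_def by (rule contour_integral_unique)
  qed
  hence "\<forall>\<^sub>F x in nhds w. dixon_int x = g x - g 0"
    using eventually_nhds_in_open[of "ball 0 1" w] assms by (auto elim!: eventually_mono)
  moreover have "((\<lambda>x. g x - g 0) has_field_derivative ?f w) (at w)"
    using g[of w] assms by (auto intro!: derivative_eq_intros simp: at_within_open[of _ "ball 0 1"])
  ultimately show ?thesis
    unfolding f_eq by (subst DERIV_cong_ev[OF refl _ refl]) auto
qed

lemma dixon_int_0 [simp]: "dixon_int 0 = 0"
  by (simp add: dixon_int_def)

lemma dixon_int_holomorphic: "dixon_int holomorphic_on ball 0 1"
  using has_field_derivative_dixon_int unfolding holomorphic_on_open[OF open_ball] by fastforce

lemma eventually_eq_const_of_deriv_zero:
  fixes H :: "complex \<Rightarrow> complex"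
  assumes "\<forall>\<^sub>F z in nhds z0. (H has_field_derivative 0) (at z)"
  shows   "\<forall>\<^sub>F z in nhds z0. H z = H z0"
proof -
  obtain r where r: "r > 0" "\<And>z. dist z z0 < r \<Longrightarrow> (H has_field_derivative 0) (at z)"
    using assms unfolding eventually_nhds_metric by auto
  obtain c where "\<forall>z\<in>ball z0 r. H z = c"
    using has_field_derivative_zero_constant[of "ball z0 r" H] r(2)
    by (auto simp: dist_commute intro: has_field_derivative_at_within)
  thus ?thesis
    unfolding eventually_nhds_metric using r(1)
    by (intro exI[of _ r]) (auto simp: dist_commute)
qed

lemma isCont_imp_tendsto_nhds: "isCont f z \<Longrightarrow> (f \<longlongrightarrow> f z) (nhds z)"
  by (simp only: isCont_def tendsto_at_iff_tendsto_nhds)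

text \<open>
  Identities on the curve \<open>x ^ 3 + y ^ 3 = 1\<close> determine only the cube of a coordinate. Near a positive real number the
  argument of \<open>w\<close> is below \<open>pi / 3\<close>, so the principal cube root of \<open>w ^ 3\<close> is \<open>w\<close> itself.
\<close>

lemma eventually_powr_third_power3:
  assumes "r > 0"
  shows   "\<forall>\<^sub>F w in nhds (complex_of_real r). (w ^ 3) powr (1 / 3) = w"
proof -
  have "isCont (\<lambda>w. Im (Ln w)) (complex_of_real r)"
    using assms by (intro isCont_Im isCont_Ln') auto
  from isCont_imp_tendsto_nhds[OF this]
  have lim: "((\<lambda>w. Im (Ln w)) \<longlongrightarrow> 0) (nhds (complex_of_real r))"
    using assms by (simp add: Ln_of_real)
  have "\<forall>\<^sub>F w in nhds (complex_of_real r). Im (Ln w) < pi / 3"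
        "\<forall>\<^sub>F w in nhds (complex_of_real r). - (pi / 3) < Im (Ln w)"
    using order_tendstoD(2)[OF lim, of "pi / 3"] order_tendstoD(1)[OF lim, of "- (pi / 3)"] by auto
  moreover have "\<forall>\<^sub>F w in nhds (complex_of_real r). w \<noteq> 0"
    using assms by (intro t1_space_nhds) auto
  ultimately show ?thesis
  proof eventually_elim
    case (elim w)
    have "w ^ 3 = exp (3 * Ln w)"
      using elim exp_of_nat_mult[of 3 "Ln w"] by simp
    hence "Ln (w ^ 3) = 3 * Ln w"
      using elim by (simp add: Ln_exp)
    thus ?case
      using elim by (simp add: powr_def)
  qed
qed

text \<open>
  Doubling on the cubic \<open>x ^ 3 + y ^ 3 = 1\<close>. Write \<open>c\<close> for \<open>dixon_root y\<close>. In the group law with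
  origin \<open>(0, 1)\<close> the double of \<open>(y, c)\<close> is the point \<open>(D, C)\<close> with \<open>D = y * (2 - y ^ 3) / (c * (1 + y ^ 3))\<close> and
  \<open>C = (1 - 2 * y ^ 3) / (c * (1 + y ^ 3))\<close>. It lies on the curve, and \<open>D' = 2 * C ^ 2 / c ^ 2\<close>, which says that
  the map \<open>y \<mapsto> D\<close> doubles the invariant differential \<open>dy / c ^ 2\<close>. Hence both sides of the formula have
  the same derivative.
\<close>

lemma dixon_int_duplication:
  "\<forall>\<^sub>F y in nhds 0.
     dixon_int (y * (2 - y ^ 3) / (dixon_root y * (1 + y ^ 3))) = 2 * dixon_int y"
proof -
  define D where "D = (\<lambda>y. y * (2 - y ^ 3) / (dixon_root y * (1 + y ^ 3)))"
  define C where "C = (\<lambda>y. (1 - 2 * y ^ 3) / (dixon_root y * (1 + y ^ 3)))"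
  have cont_root: "isCont dixon_root 0"
    using has_field_derivative_dixon_root[of 0] by (simp add: DERIV_isCont)
  have "isCont D 0" "isCont C 0"
    unfolding D_def C_def by (intro continuous_intros cont_root; simp)+
  hence lim: "(D \<longlongrightarrow> D 0) (nhds 0)" "(C \<longlongrightarrow> C 0) (nhds 0)"
    by (auto intro: isCont_imp_tendsto_nhds)
  have [simp]: "D 0 = 0" "C 0 = 1"
    by (simp_all add: D_def C_def)
  have "\<forall>\<^sub>F y in nhds 0. D y \<in> ball 0 1"
    using lim(1) by (intro topological_tendstoD[OF lim(1)]) auto
  moreover have "\<forall>\<^sub>F y in nhds 0. (C y ^ 3) powr (1 / 3) = C y"
    using eventually_compose_filterlim[OF eventually_powr_third_power3[of 1]] lim(2) by simp
  moreover have "\<forall>\<^sub>F y in nhds 0. C y \<noteq> 0"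
    by (rule tendsto_imp_eventually_ne[OF lim(2)]) simp
  moreover have "\<forall>\<^sub>F y::complex in nhds 0. y \<in> ball 0 1"
    by (rule eventually_nhds_in_open) auto
  ultimately have "\<forall>\<^sub>F y in nhds 0.
      ((\<lambda>y. dixon_int (D y) - 2 * dixon_int y) has_field_derivative 0) (at y)"
  proof eventually_elim
    case (elim y)
    define c where "c = dixon_root y"
    have y: "norm y < 1"
      using elim by simp
    have c: "c \<noteq> 0" "c ^ 3 = 1 - y ^ 3"
      using dixon_root_nonzero[OF y] by (simp_all add: c_def dixon_root_power3)
    have "norm (y ^ 3) < 1"
      using y by (simp add: norm_power power_less_one_iff)
    hence nz: "1 + y ^ 3 \<noteq> 0"
      by (metis add_eq_0_iff less_irrefl norm_minus_cancel norm_one)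
    have cubes: "D y ^ 3 + C y ^ 3 = 1"
    proof -
      have "(y * (2 - y ^ 3)) ^ 3 + (1 - 2 * y ^ 3) ^ 3 = c ^ 3 * (1 + y ^ 3) ^ 3"
        unfolding c by (simp add: algebra_simps eval_nat_numeral)
      moreover have "D y = y * (2 - y ^ 3) / (c * (1 + y ^ 3))" "C y = (1 - 2 * y ^ 3) / (c * (1 + y ^ 3))"
        by (simp_all add: C_def D_def c_def)
      ultimately show ?thesis
        using c(1) nz by (simp add: power_divide power_mult_distrib flip: add_divide_distrib)
    qed
    \<comment> \<open>As \<open>C y\<close> is close to \<open>C 0 = 1\<close>, it is the principal cube root.\<close>
    have root: "dixon_root (D y) = C y"
    proof -
      have "1 - D y ^ 3 = C y ^ 3"
        using cubes by (simp add: algebra_simps)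
      thus ?thesis
        using elim by (simp add: dixon_root_def)
    qed
    have D': "(D has_field_derivative 2 * C y ^ 2 / c ^ 2) (at y)"
    proof -
      have "(D has_field_derivative
              ((2 - 4 * y ^ 3) * (c * (1 + y ^ 3)) -
               y * (2 - y ^ 3) * (- (y ^ 2 / c ^ 2) * (1 + y ^ 3) + c * (3 * y ^ 2)))
              / (c * (1 + y ^ 3)) ^ 2) (at y)"
      proof -
        have N: "((\<lambda>y. y * (2 - y ^ 3)) has_field_derivative 2 - 4 * y ^ 3) (at y)"
          by (rule derivative_eq_intros refl)+ (simp add: algebra_simps eval_nat_numeral)
        have M: "((\<lambda>y. dixon_root y * (1 + y ^ 3)) has_field_derivative
                   - (y ^ 2 / c ^ 2) * (1 + y ^ 3) + c * (3 * y ^ 2)) (at y)"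
          unfolding c_def
          by (rule derivative_eq_intros has_field_derivative_dixon_root y refl)+ simp
        show ?thesis
          using DERIV_divide[OF N M] nz c(1)
          by (simp add: D_def c_def power2_eq_square)
      qed
      also have "((2 - 4 * y ^ 3) * (c * (1 + y ^ 3)) -
               y * (2 - y ^ 3) * (- (y ^ 2 / c ^ 2) * (1 + y ^ 3) + c * (3 * y ^ 2)))
            = ((2 - 4 * y ^ 3) * (c ^ 3 * (1 + y ^ 3)) -
               y * (2 - y ^ 3) * (- (y ^ 2) * (1 + y ^ 3) + c ^ 3 * (3 * y ^ 2))) / c ^ 2"
        using c(1) by (simp add: field_simps eval_nat_numeral)
      also have "\<dots> = 2 * (1 - 2 * y ^ 3) ^ 2 / c ^ 2"
        unfolding c by (simp add: algebra_simps eval_nat_numeral)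
      also have "\<dots> / (c * (1 + y ^ 3)) ^ 2 = 2 * C y ^ 2 / c ^ 2"
        by (simp add: C_def c_def power_divide)
      finally show ?thesis .
    qed
    have "((\<lambda>y. dixon_int (D y)) has_field_derivative 1 / C y ^ 2 * (2 * C y ^ 2 / c ^ 2)) (at y)"
      using has_field_derivative_dixon_int[of "D y"] elim root
      by (intro DERIV_chain2[OF _ D']) auto
    hence "((\<lambda>y. dixon_int (D y)) has_field_derivative 2 / c ^ 2) (at y)"
      using elim by simp
    from DERIV_diff[OF this DERIV_cmult[OF has_field_derivative_dixon_int[OF y], of 2]]
    show ?case
      by (simp add: c_def)
  qed
  from eventually_eq_const_of_deriv_zero[OF this] show ?thesis
    by (simp add: D_def)
qed

section \<open>Identity theorems for meromorphic functions\<close>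

lemma meromorphic_identity:
  assumes "f meromorphic_on A" "g meromorphic_on A" "open A" "connected A" "z \<in> A" "w \<in> A"
  assumes "\<forall>\<^sub>F x in at z. f x = g x"
  shows   "\<forall>\<^sub>F x in at w. f x = g x"
proof -
  define h where "h = (\<lambda>x. f x - g x)"
  have h: "h meromorphic_on A"
    unfolding h_def by (intro meromorphic_intros assms)
  have ev: "\<forall>\<^sub>F y in at x. remove_sings h y = h y" if "x \<in> A" for x
    by (rule eventually_remove_sings_eq_at)
       (use h that in \<open>auto simp: meromorphic_on_altdef\<close>)
  have "\<forall>\<^sub>F x in at z. remove_sings h x = 0"
    using ev[OF \<open>z \<in> A\<close>] assms(7) by eventually_elim (auto simp: h_def)
  hence zero: "remove_sings h x = 0" if "x \<in> A" for x
    using frequently_eq_meromorphic_imp_constant[of "remove_sings h" 0 z A x] that assms(3-5)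
      remove_sings_nicely_meromorphic[OF h] by (simp add: eventually_frequently)
  have "\<forall>\<^sub>F x in at w. x \<in> A"
    using assms(3,6) by (rule eventually_at_in_open')
  with ev[OF \<open>w \<in> A\<close>] show ?thesis
    by eventually_elim (use zero in \<open>auto simp: h_def\<close>)
qed

text \<open>
  The normalisation of the values at poles upgrades equality off an isolated set to equality everywhere.
\<close>

lemma nicely_meromorphic_identity:
  assumes "f nicely_meromorphic_on A" "g nicely_meromorphic_on A"
  assumes "open A" "connected A" "z \<in> A" "w \<in> A"
  assumes "\<forall>\<^sub>F x in at z. f x = g x"
  shows   "f w = g w"
proof -
  have ev: "\<forall>\<^sub>F x in at w. f x = g x"
    using assms by (intro meromorphic_identity[of f A g z w]) (auto simp: nicely_meromorphic_on_def)
  have f: "(is_pole f w \<and> f w = 0) \<or> f \<midarrow>w\<rightarrow> f w" and g: "(is_pole g w \<and> g w = 0) \<or> g \<midarrow>w\<rightarrow> g w"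
    using assms by (auto simp: nicely_meromorphic_on_def)
  have pole: "is_pole f w \<longleftrightarrow> is_pole g w"
    by (rule is_pole_cong[OF ev refl])
  have no_pole: "\<not> is_pole g w" if "g \<midarrow>w\<rightarrow> c" for c
    using that not_tendsto_and_filterlim_at_infinity[of "at w" g c]
    by (auto simp: is_pole_def)
  have lim: "f \<midarrow>w\<rightarrow> c \<longleftrightarrow> g \<midarrow>w\<rightarrow> c" for c
    by (rule tendsto_cong[OF ev])
  show ?thesis
    using f g pole no_pole lim LIM_unique by metis
qed

section \<open>Existence and uniqueness of the function sm\<close>

text \<open>
  The defining property of sm with the plane replaced by a set, so that solutions on growing discs can be discussed.
\<close>

definition dixon_sm_on :: "(complex \<Rightarrow> complex) \<Rightarrow> complex set \<Rightarrow> bool" where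
  "dixon_sm_on s A \<longleftrightarrow>
     s nicely_meromorphic_on A \<and> s analytic_on {0} \<and> s 0 = 0 \<and>
     (\<forall>\<^sub>F z in nhds 0. dixon_int (s z) = z)"

lemma is_dixon_sm_iff: "is_dixon_sm s \<longleftrightarrow> dixon_sm_on s UNIV"
  by (simp add: is_dixon_sm_def dixon_sm_on_def dixon_int_def)

lemma dixon_sm_on_subset: "dixon_sm_on s A \<Longrightarrow> B \<subseteq> A \<Longrightarrow> dixon_sm_on s B"
  by (auto simp: dixon_sm_on_def intro: nicely_meromorphic_on_subset)

lemma dixon_int_locally_injective:
  obtains r where "r > 0" "r \<le> 1" "inj_on dixon_int (ball 0 r)"
proof -
  have "deriv dixon_int 0 = 1"
    using has_field_derivative_dixon_int[of 0] by (simp add: DERIV_imp_deriv)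
  then obtain r where "r > 0" "ball 0 r \<subseteq> ball (0::complex) 1" "inj_on dixon_int (ball 0 r)"
    using has_complex_derivative_locally_injective[OF dixon_int_holomorphic, of 0] by auto
  thus ?thesis
    using that[of r] by (auto simp: ball_subset_ball_iff)
qed

lemma analytic_at_tendsto_nhds:
  assumes "f analytic_on {z}"
  shows   "(f \<longlongrightarrow> f z) (nhds z)"
  by (rule isCont_imp_tendsto_nhds[OF analytic_at_imp_isCont[OF assms]])

text \<open>
  Near \<open>0\<close> two solutions take values near \<open>0\<close>, where the integral is injective; so they agree near \<open>0\<close> and, by the
  identity theorem, on all of \<open>A\<close>.
\<close>

lemma dixon_sm_on_unique:
  assumes s: "dixon_sm_on s A" and t: "dixon_sm_on t A"
  assumes "open A" "connected A" "0 \<in> A" "w \<in> A"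
  shows   "s w = t w"
proof -
  obtain r where r: "r > 0" "inj_on dixon_int (ball 0 r)"
    using dixon_int_locally_injective by blast
  have lim: "(s \<longlongrightarrow> 0) (nhds 0)" "(t \<longlongrightarrow> 0) (nhds 0)"
    using s t analytic_at_tendsto_nhds[of s 0] analytic_at_tendsto_nhds[of t 0]
    by (auto simp: dixon_sm_on_def)
  have "\<forall>\<^sub>F z in nhds 0. s z \<in> ball 0 r" "\<forall>\<^sub>F z in nhds 0. t z \<in> ball 0 r"
    using tendstoD[OF lim(1) r(1)] tendstoD[OF lim(2) r(1)] by simp_all
  moreover have "\<forall>\<^sub>F z in nhds 0. dixon_int (s z) = z" "\<forall>\<^sub>F z in nhds 0. dixon_int (t z) = z"
    using s t by (auto simp: dixon_sm_on_def)
  ultimately have "\<forall>\<^sub>F z in nhds 0. s z = t z"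
    by eventually_elim (rule inj_onD[OF r(2)], simp_all)
  hence "\<forall>\<^sub>F z in at 0. s z = t z"
    by (simp add: eventually_nhds_conv_at)
  thus ?thesis
    using assms by (intro nicely_meromorphic_identity[of s A t 0 w]) (auto simp: dixon_sm_on_def)
qed

lemma dixon_sm_on_ball_exists:
  obtains r s where "r > 0" "dixon_sm_on s (ball 0 r)"
proof -
  obtain r where r: "r > 0" "r \<le> 1" "inj_on dixon_int (ball 0 r)"
    using dixon_int_locally_injective by blast
  have holo: "dixon_int holomorphic_on ball 0 r"
    using dixon_int_holomorphic r(2) by (rule holomorphic_on_subset[OF _ subset_ball])
  obtain s where s: "s holomorphic_on dixon_int ` ball 0 r" "\<And>z. z \<in> ball 0 r \<Longrightarrow> s (dixon_int z) = z"
    using holomorphic_has_inverse[OF holo open_ball r(3)] by metis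
  have "open (dixon_int ` ball 0 r)"
    by (rule open_mapping_thm3[OF holo open_ball r(3)])
  moreover have "0 \<in> dixon_int ` ball 0 r"
    using r(1) dixon_int_0 by (metis centre_in_ball imageI)
  ultimately obtain e where e: "e > 0" "ball 0 e \<subseteq> dixon_int ` ball 0 r"
    by (meson open_contains_ball)
  have an: "s analytic_on ball 0 e"
    using s(1) e(2) by (simp add: analytic_on_open holomorphic_on_subset)
  have "dixon_int (s z) = z" if "z \<in> ball 0 e" for z
    using that e(2) s(2) by force
  hence "\<forall>\<^sub>F z in nhds 0. dixon_int (s z) = z"
    using eventually_nhds_in_open[of "ball 0 e" 0] e(1) by (auto elim!: eventually_mono)
  moreover have "s 0 = 0"
    using s(2)[of 0] r(1) by simp
  moreover have "s analytic_on {0}"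
    using an by (rule analytic_on_subset) (use e(1) in auto)
  ultimately have "dixon_sm_on s (ball 0 e)"
    using analytic_on_imp_nicely_meromorphic_on[OF an] by (auto simp: dixon_sm_on_def)
  thus ?thesis
    using that e(1) by blast
qed

text \<open>
  The algebraic operations that continue sm produce arbitrary values at poles and removable singularities. Normalising them
  afterwards does not disturb the behaviour at the analytic point \<open>0\<close>.
\<close>

lemma dixon_sm_on_remove_sings:
  assumes "s meromorphic_on A" "s analytic_on {0}" "s 0 = 0"
  assumes "\<forall>\<^sub>F z in nhds 0. dixon_int (s z) = z"
  shows   "dixon_sm_on (remove_sings s) A"
proof -
  have "\<forall>\<^sub>F z in nhds 0. dixon_int (remove_sings s z) = z"
    using eventually_remove_sings_eq_nhds[OF assms(2)] assms(4) by eventually_elim simp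
  thus ?thesis
    using assms by (auto simp: dixon_sm_on_def remove_sings_nicely_meromorphic remove_sings_analytic_on)
qed

text \<open>
  This is the differential equation \<open>sm' = cm ^ 2\<close>. In this form it holds only near \<open>0\<close>, where \<open>dixon_root (s z)\<close> is on the right
  branch.
\<close>

lemma dixon_sm_on_deriv:
  assumes "dixon_sm_on s A"
  shows   "\<forall>\<^sub>F z in nhds 0. deriv s z = dixon_root (s z) ^ 2"
proof -
  have lim: "(s \<longlongrightarrow> 0) (nhds 0)"
    using assms analytic_at_tendsto_nhds[of s 0] by (auto simp: dixon_sm_on_def)
  have "\<forall>\<^sub>F z in nhds 0. s z \<in> ball 0 1"
    using tendstoD[OF lim, of 1] by simp
  moreover have "\<forall>\<^sub>F z in nhds 0. \<forall>\<^sub>F y in nhds z. dixon_int (s y) = y"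
    using assms by (simp add: dixon_sm_on_def eventually_eventually)
  moreover have "\<forall>\<^sub>F z in nhds 0. s analytic_on {z}"
  proof -
    obtain A where "open A" "0 \<in> A" "s holomorphic_on A"
      using assms by (auto simp: dixon_sm_on_def analytic_at)
    thus ?thesis
      by (intro eventually_mono[OF eventually_nhds_in_open[of A 0]]) (auto intro: holomorphic_on_imp_analytic_at)
  qed
  ultimately show ?thesis
  proof eventually_elim
    case (elim z)
    have "(s has_field_derivative deriv s z) (at z)"
      using elim analytic_on_imp_differentiable_at by (auto simp: DERIV_deriv_iff_field_differentiable)
    hence "((\<lambda>y. dixon_int (s y)) has_field_derivative 1 / dixon_root (s z) ^ 2 * deriv s z) (at z)"
      using elim by (intro DERIV_chain2[OF has_field_derivative_dixon_int]) auto
    moreover have "((\<lambda>y. dixon_int (s y)) has_field_derivative 1) (at z)"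
      using elim by (subst DERIV_cong_ev[OF refl _ refl, of _ "\<lambda>y. y"]) auto
    ultimately have "1 / dixon_root (s z) ^ 2 * deriv s z = 1"
      by (rule DERIV_unique)
    thus ?case
      using dixon_root_nonzero[of "s z"] elim by (simp add: field_simps)
  qed
qed

text \<open>
  The duplication formula involves \<open>cm z\<close>, which is a principal cube root only near \<open>0\<close>. Replacing it by means of
  \<open>sm' = cm ^ 2\<close> and \<open>cm ^ 3 = 1 - sm ^ 3\<close>, that is \<open>cm = sm' ^ 2 / (1 - sm ^ 3)\<close>, gives an expression in \<open>s\<close>
  and \<open>deriv s\<close> that is meromorphic wherever \<open>s\<close> is.
\<close>

lemma dixon_sm_on_double:
  assumes s: "dixon_sm_on s (ball 0 R)"
  shows   "\<exists>t. dixon_sm_on t (ball 0 (2 * R))"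
proof -
  define q where "q = (\<lambda>z. s z * (2 - s z ^ 3) * (1 - s z ^ 3) / (deriv s z ^ 2 * (1 + s z ^ 3)))"
  have s0: "s 0 = 0" "s analytic_on {0}"
    using s by (auto simp: dixon_sm_on_def)
  have lim: "(s \<longlongrightarrow> 0) (nhds 0)"
    using s0 analytic_at_tendsto_nhds[of s 0] by simp
  have "deriv s 0 = 1"
    using eventually_nhds_x_imp_x[OF dixon_sm_on_deriv[OF s]] s0 by simp
  hence q_an: "q analytic_on {0}"
    unfolding q_def by (intro analytic_intros s0) (simp add: s0)
  have q0: "q 0 = 0"
    by (simp add: q_def s0)
  have q_mero: "q meromorphic_on ball 0 R"
    using s unfolding q_def dixon_sm_on_def nicely_meromorphic_on_def
    by (intro meromorphic_intros) auto
  have "\<forall>\<^sub>F z in nhds 0. s z \<in> ball 0 1"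
    using tendstoD[OF lim, of 1] by simp
  moreover have "\<forall>\<^sub>F z in nhds 0. dixon_int (s z) = z"
    using s by (simp add: dixon_sm_on_def)
  moreover note dixon_sm_on_deriv[OF s]
  moreover have "\<forall>\<^sub>F z in nhds 0. 
      dixon_int (s z * (2 - s z ^ 3) / (dixon_root (s z) * (1 + s z ^ 3))) = 2 * dixon_int (s z)"
    by (rule eventually_compose_filterlim[OF dixon_int_duplication lim])
  ultimately have q_int: "\<forall>\<^sub>F z in nhds 0. dixon_int (q z) = 2 * z"
  proof eventually_elim
    case (elim z)
    have "q z = s z * (2 - s z ^ 3) * dixon_root (s z) ^ 3 / (dixon_root (s z) ^ 4 * (1 + s z ^ 3))"
      using elim by (simp add: q_def dixon_root_power3)
    also have "\<dots> = s z * (2 - s z ^ 3) / (dixon_root (s z) * (1 + s z ^ 3))"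
      using dixon_root_nonzero[of "s z"] elim
      by (simp add: divide_simps) (simp add: eval_nat_numeral)
    finally show ?case
      using elim by simp
  qed
  have half: "((\<lambda>z::complex. z / 2) \<longlongrightarrow> 0) (nhds 0)"
    using isCont_imp_tendsto_nhds[where f = "\<lambda>z::complex. z / 2" and z = 0] by simp
  have "dixon_sm_on (remove_sings (\<lambda>z. q (z / 2))) (ball 0 (2 * R))"
  proof (rule dixon_sm_on_remove_sings)
    show "(\<lambda>z. q (z / 2)) meromorphic_on ball 0 (2 * R)"
      by (rule meromorphic_on_compose[OF q_mero])
         (auto intro!: analytic_intros simp: norm_divide)
    show "(\<lambda>z. q (z / 2)) analytic_on {0}"
      by (rule analytic_on_compose_gen[of "\<lambda>z. z / 2" "{0}" q "{0}", unfolded o_def])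
         (use q_an in \<open>auto intro!: analytic_intros\<close>)
    show "\<forall>\<^sub>F z in nhds 0. dixon_int (q (z / 2)) = z"
      using eventually_compose_filterlim[OF q_int half] by simp
  qed (simp add: q0)
  thus ?thesis
    by blast
qed

text \<open>
  Repeated doubling starting from the local inverse of the integral reaches every disc; by uniqueness these solutions are
  restrictions of a single function.
\<close>

lemma dixon_sm_on_UNIV_exists: "\<exists>s. dixon_sm_on s UNIV"
proof -
  obtain r s0 where r: "r > 0" "dixon_sm_on s0 (ball 0 r)"
    using dixon_sm_on_ball_exists by blast
  have "\<exists>s. dixon_sm_on s (ball 0 (2 ^ n * r))" for n
  proof (induction n)
    case (Suc n)
    thus ?case
      using dixon_sm_on_double[of _ "2 ^ n * r"] by (auto simp: mult.assoc)
  qed (use r in auto)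
  then obtain S where S: "\<And>n. dixon_sm_on (S n) (ball 0 (2 ^ n * r))"
    by metis
  have agree_le: "S m z = S n z" if "z \<in> ball 0 (2 ^ m * r)" "m \<le> n" for m n z
  proof (rule dixon_sm_on_unique[of "S m" "ball 0 (2 ^ m * r)" "S n" z])
    show "dixon_sm_on (S n) (ball 0 (2 ^ m * r))"
      using r(1) that(2) by (intro dixon_sm_on_subset[OF S[of n]] subset_ball mult_right_mono) auto
  qed (use S that r(1) in auto)
  have agree: "S m z = S n z" if "z \<in> ball 0 (2 ^ m * r)" "z \<in> ball 0 (2 ^ n * r)" for m n z
    using agree_le[OF that(1), of n] agree_le[OF that(2), of m, symmetric] nat_le_linear[of m n] by blast
  have exhaust: "\<exists>n. z \<in> ball 0 (2 ^ n * r)" for z :: complex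
    using real_arch_pow[of 2 "norm z / r"] r(1) by (simp add: pos_divide_less_eq)
  define s where "s = (\<lambda>z. S (LEAST n. z \<in> ball 0 (2 ^ n * r)) z)"
  have s_eq: "s z = S n z" if "z \<in> ball 0 (2 ^ n * r)" for n z
    unfolding s_def by (rule agree[OF LeastI_ex[OF exhaust] that])
  have ev: "\<forall>\<^sub>F w in nhds z. s w = S n w" if "z \<in> ball 0 (2 ^ n * r)" for n z
    using eventually_nhds_in_open[OF open_ball that] by eventually_elim (rule s_eq)
  have "s nicely_meromorphic_on UNIV"
    unfolding nicely_meromorphic_on_def
  proof (intro conjI ballI)
    fix z :: complex
    obtain n where z: "z \<in> ball 0 (2 ^ n * r)"
      using exhaust by blast
    have ev': "\<forall>\<^sub>F w in at z. s w = S n w"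
      using ev[OF z] by (simp add: eventually_nhds_conv_at)
    have "(is_pole (S n) z \<and> S n z = 0) \<or> S n \<midarrow>z\<rightarrow> S n z"
      using S[of n] z by (auto simp: dixon_sm_on_def nicely_meromorphic_on_def)
    thus "(is_pole s z \<and> s z = 0) \<or> s \<midarrow>z\<rightarrow> s z"
      unfolding s_eq[OF z] is_pole_cong[OF ev' refl] tendsto_cong[OF ev'] .
  next
    show "s meromorphic_on UNIV"
    proof (subst meromorphic_on_meromorphic_at, rule ballI)
      fix z :: complex
      obtain n where z: "z \<in> ball 0 (2 ^ n * r)"
        using exhaust by blast
      have ev': "\<forall>\<^sub>F w in at z. s w = S n w"
        using ev[OF z] by (simp add: eventually_nhds_conv_at)
      have "S n meromorphic_on {z}"
        using S[of n] z unfolding dixon_sm_on_def nicely_meromorphic_on_def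
        by (auto intro: meromorphic_on_subset)
      thus "s meromorphic_on {z}"
        using ev' meromorphic_on_cong[of "{z}" s "S n" "{z}"] by auto
    qed
  qed
  moreover have ev0: "\<forall>\<^sub>F w in nhds 0. s w = S 0 w"
    using ev[of 0 0] r(1) by simp
  have "\<forall>\<^sub>F w in nhds 0. dixon_int (s w) = w"
    using S[of 0] ev0 unfolding dixon_sm_on_def by (auto elim: eventually_elim2)
  moreover have "s analytic_on {0}" "s 0 = 0"
    using S[of 0] analytic_at_cong[OF ev0 refl] eventually_nhds_x_imp_x[OF ev0]
    by (auto simp: dixon_sm_on_def)
  ultimately show ?thesis
    by (auto simp: dixon_sm_on_def)
qed

lemma dixon_sm_on_dixon_sm: "dixon_sm_on dixon_sm UNIV"
proof -
  have "\<exists>!s. is_dixon_sm s"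
    unfolding is_dixon_sm_iff
    using dixon_sm_on_UNIV_exists dixon_sm_on_unique[of _ UNIV] by (auto intro!: ext)
  from theI'[OF this] show ?thesis
    by (simp add: dixon_sm_def is_dixon_sm_iff)
qed

text \<open>
  Near \<open>0\<close> this says that sm is the local inverse of the integral. The composition is meromorphic on the unit disc, so the
  identity theorem gives it on the disc up to isolated points. At such a point \<open>w\<close> the composition tends to \<open>w\<close>, which
  excludes a pole of sm at \<open>dixon_int w\<close> and fixes the value there.
\<close>

lemma dixon_sm_dixon_int:
  assumes "norm w < 1"
  shows   "dixon_sm (dixon_int w) = w"
proof -
  note sm = dixon_sm_on_dixon_sm
  obtain r where r: "r > 0" "inj_on dixon_int (ball 0 r)"
    using dixon_int_locally_injective by blast
  have cont: "(dixon_int \<longlongrightarrow> dixon_int z) (nhds z)" if "norm z < 1" for z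
    using DERIV_isCont[OF has_field_derivative_dixon_int[OF that]]
    by (rule isCont_imp_tendsto_nhds)
  have lim0: "(dixon_int \<longlongrightarrow> 0) (nhds 0)"
    using cont[of 0] by simp
  have sm_lim: "(dixon_sm \<longlongrightarrow> 0) (nhds 0)"
    using sm analytic_at_tendsto_nhds[of dixon_sm 0] by (auto simp: dixon_sm_on_def)
  have comp: "((\<lambda>y. dixon_sm (dixon_int y)) \<longlongrightarrow> 0) (nhds 0)"
    by (rule filterlim_compose[OF sm_lim lim0])
  have "\<forall>\<^sub>F y in nhds 0. y \<in> ball 0 r"
    using r(1) by (intro eventually_nhds_in_open) auto
  moreover have "\<forall>\<^sub>F y in nhds 0. dixon_sm (dixon_int y) \<in> ball 0 r"
    using r(1) by (intro topological_tendstoD[OF comp]) auto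
  moreover have "\<forall>\<^sub>F y in nhds 0. dixon_int (dixon_sm (dixon_int y)) = dixon_int y"
    using eventually_compose_filterlim[OF _ lim0] sm by (auto simp: dixon_sm_on_def)
  ultimately have "\<forall>\<^sub>F y in nhds 0. dixon_sm (dixon_int y) = y"
    by eventually_elim (rule inj_onD[OF r(2)], simp_all)
  hence "\<forall>\<^sub>F y in at 0. dixon_sm (dixon_int y) = y"
    by (simp add: eventually_nhds_conv_at)
  moreover have "(\<lambda>y. dixon_sm (dixon_int y)) meromorphic_on ball 0 1"
  proof (rule meromorphic_on_compose[of dixon_sm UNIV])
    show "dixon_sm meromorphic_on UNIV"
      using sm unfolding dixon_sm_on_def nicely_meromorphic_on_def by blast
    show "dixon_int analytic_on ball 0 1"
      using dixon_int_holomorphic by (simp add: analytic_on_open)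
  qed auto
  ultimately have ev: "\<forall>\<^sub>F y in at w. dixon_sm (dixon_int y) = y"
    by (rule meromorphic_identity[of _ "ball 0 1" "\<lambda>y. y" 0, rotated 6]) (use assms in auto)
  have lim: "((\<lambda>y. dixon_sm (dixon_int y)) \<longlongrightarrow> w) (at w)"
    by (subst tendsto_cong[OF ev]) (rule tendsto_ident_at)
  have at: "filterlim dixon_int (at (dixon_int w)) (at w)"
  proof (rule filterlim_atI)
    show "(dixon_int \<longlongrightarrow> dixon_int w) (at w)"
      using DERIV_isCont[OF has_field_derivative_dixon_int[OF assms]] by (simp add: isCont_def)
    show "\<forall>\<^sub>F y in at w. dixon_int y \<noteq> dixon_int w"
      \<comment> \<open>Near \<open>w\<close>, \<open>dixon_int y = dixon_int w\<close> forces \<open>y\<close> to be one fixed point.\<close>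
      using ev eventually_neq_at_within[of "dixon_sm (dixon_int w)" w UNIV]
      by eventually_elim auto
  qed
  show ?thesis
  proof (cases "is_pole dixon_sm (dixon_int w)")
    case True
    hence "filterlim (\<lambda>y. dixon_sm (dixon_int y)) at_infinity (at w)"
      unfolding is_pole_def by (rule filterlim_compose[OF _ at])
    thus ?thesis
      using not_tendsto_and_filterlim_at_infinity[OF _ lim] by simp
  next
    case False
    hence "dixon_sm \<midarrow>dixon_int w\<rightarrow> dixon_sm (dixon_int w)"
      using sm by (auto simp: dixon_sm_on_def nicely_meromorphic_on_def)
    hence "((\<lambda>y. dixon_sm (dixon_int y)) \<longlongrightarrow> dixon_sm (dixon_int w)) (at w)"
      by (rule filterlim_compose[OF _ at])
    thus ?thesis
      using lim LIM_unique by blast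
  qed
qed

section \<open>The constant pi3\<close>

lemma has_real_derivative_dixon_int:
  assumes "\<bar>x\<bar> < 1"
  shows   "((\<lambda>x. Re (dixon_int (of_real x))) has_real_derivative 1 / (1 - x ^ 3) powr (2 / 3)) (at x)"
proof -
  have "\<bar>x ^ 3\<bar> < 1"
    using assms by (simp add: power_abs power_less_one_iff)
  hence "complex_of_real (1 - x ^ 3) powr complex_of_real (1 / 3) = of_real ((1 - x ^ 3) powr (1 / 3))"
    by (intro powr_of_real) auto
  hence root: "dixon_root (of_real x) = of_real ((1 - x ^ 3) powr (1 / 3))"
    by (simp add: dixon_root_def)
  have "((1 - x ^ 3) powr (1 / 3)) ^ 2 = (1 - x ^ 3) powr (2 / 3)"
    by (simp add: power2_eq_square flip: powr_add)
  hence "1 / dixon_root (of_real x) ^ 2 = of_real (1 / (1 - x ^ 3) powr (2 / 3))"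
    unfolding root by (simp flip: of_real_power)
  hence "((\<lambda>x. dixon_int (of_real x)) has_vector_derivative of_real (1 / (1 - x ^ 3) powr (2 / 3))) (at x)"
    using has_field_derivative_dixon_int[of "of_real x"] assms
    by (intro has_vector_derivative_real_field) simp
  from bounded_linear.has_vector_derivative[OF bounded_linear_Re this] show ?thesis
    by (simp add: has_real_derivative_iff_has_vector_derivative)
qed

lemma has_integral_dixon_int:
  assumes "0 \<le> x" "x < 1"
  shows   "((\<lambda>y. 1 / (1 - y ^ 3) powr (2 / 3)) has_integral Re (dixon_int (of_real x))) {0..x}"
proof -
  have "((\<lambda>y. 1 / (1 - y ^ 3) powr (2 / 3)) has_integral
          Re (dixon_int (of_real x)) - Re (dixon_int (of_real 0))) {0..x}"
  proof (rule fundamental_theorem_of_calculus)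
    fix y assume "y \<in> {0..x}"
    hence "\<bar>y\<bar> < 1"
      using assms by auto
    from has_real_derivative_dixon_int[OF this]
    show "((\<lambda>x. Re (dixon_int (of_real x))) has_vector_derivative 1 / (1 - y ^ 3) powr (2 / 3)) (at y within {0..x})"
      by (simp add: has_field_derivative_at_within flip: has_real_derivative_iff_has_vector_derivative)
  qed (use assms in auto)
  thus ?thesis
    by simp
qed

text \<open>
  With \<open>has_integral_dixon_int\<close> this identifies the complex line integral with the real integral that occurs in the
  definition of \<open>pi3\<close>.
\<close>

lemma dixon_int_of_real:
  assumes "0 < x" "x < 1"
  shows   "dixon_int (of_real x) = of_real (Re (dixon_int (of_real x)))"
proof -
  have "((complex_of_real \<circ> (\<lambda>y. 1 / (1 - y ^ 3) powr (2 / 3))) has_integral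
           of_real (Re (dixon_int (of_real x)))) {0..x}"
    using assms by (intro has_integral_linear[OF _ bounded_linear_of_real] has_integral_dixon_int) auto
  also have "?this \<longleftrightarrow> ((\<lambda>y. 1 / (1 - complex_of_real y ^ 3) powr (2 / 3)) has_integral
           of_real (Re (dixon_int (of_real x)))) {0..x}"
  proof (rule has_integral_cong)
    fix y assume y: "y \<in> {0..x}"
    hence "y ^ 3 \<le> 1"
      using assms by (intro power_le_one) auto
    hence "complex_of_real (1 - y ^ 3) powr complex_of_real (2 / 3) = of_real ((1 - y ^ 3) powr (2 / 3))"
      by (intro powr_of_real) auto
    thus "(complex_of_real \<circ> (\<lambda>y. 1 / (1 - y ^ 3) powr (2 / 3))) y =
            1 / (1 - complex_of_real y ^ 3) powr (2 / 3)"
      by simp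
  qed
  finally have "((\<lambda>y. 1 / (1 - y ^ 3) powr (2 / 3)) has_contour_integral
                    of_real (Re (dixon_int (of_real x)))) (linepath 0 (of_real x))"
    using assms by (subst has_contour_integral_linepath_Reals_iff) auto
  thus ?thesis
    unfolding dixon_int_def[of "of_real x"] by (intro contour_integral_unique) (simp add: dixon_int_def)
qed

text \<open>
  Let \<open>r y = (1 - y ^ 3) powr (1 / 3)\<close> and let \<open>G\<close> be the integral from \<open>0\<close>. Since \<open>r ^ 3 = 1 - y ^ 3\<close>, the function
  \<open>- G (r y)\<close> is another primitive of the integrand. It is continuous up to \<open>y = 1\<close>, where the integrand is singular and
  \<open>r\<close> vanishes; so the fundamental theorem applies on \<open>{y0..1}\<close> and shows at once that the improper integral exists and
  that the part above the fixed point \<open>y0\<close> of \<open>r\<close> equals the part below it.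
\<close>

lemma dixon_int_inverse_cbrt_2: "dixon_int (of_real ((1 / 2) powr (1 / 3))) = of_real (pi3 / 6)"
proof -
  define y0 :: real where "y0 = (1 / 2) powr (1 / 3)"
  define G :: "real \<Rightarrow> real" where "G = (\<lambda>x. Re (dixon_int (of_real x)))"
  define r :: "real \<Rightarrow> real" where "r = (\<lambda>y. (1 - y ^ 3) powr (1 / 3))"
  let ?f = "\<lambda>y::real. 1 / (1 - y ^ 3) powr (2 / 3)"
  have y0_cube: "y0 ^ 3 = 1 / 2"
    by (simp add: y0_def powr_power)
  have y0: "0 < y0" "y0 < 1"
  proof -
    show "0 < y0"
      by (simp add: y0_def)
    show "y0 < 1"
      using power_less_imp_less_base[of y0 3 1] y0_cube by simp
  qed
  have r_bounds: "0 \<le> r y" "r y < 1" if "y \<in> {y0..1}" for y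
  proof -
    have "y0 ^ 3 \<le> y ^ 3" "y ^ 3 \<le> 1"
      using that y0 by (auto intro!: power_mono power_le_one)
    thus "0 \<le> r y" "r y < 1"
      using y0_cube powr_less_mono2[of "1 / 3" "1 - y ^ 3" 1] that y0 by (auto simp: r_def)
  qed
  have G': "(G has_real_derivative 1 / (1 - x ^ 3) powr (2 / 3)) (at x)" if "\<bar>x\<bar> < 1" for x
    unfolding G_def by (rule has_real_derivative_dixon_int[OF that])
  have "(?f has_integral (- G (r 1)) - (- G (r y0))) {y0..1}"
  proof (rule fundamental_theorem_of_calculus_interior)
    show "continuous_on {y0..1} (\<lambda>y. - G (r y))"
    proof (rule continuous_on_minus, rule continuous_on_compose2[of "{0..<1}" G])
      show "continuous_on {0..<1} G"
        by (rule continuous_at_imp_continuous_on) (auto intro!: DERIV_isCont[OF G'])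
      show "continuous_on {y0..1} r"
        unfolding r_def using y0
        by (intro continuous_on_powr' continuous_intros) (auto intro: power_le_one)
      show "r ` {y0..1} \<subseteq> {0..<1}"
        using r_bounds by auto
    qed
  next
    fix y assume y: "y \<in> {y0<..<1}"
    have y_pos: "0 < y"
      using y y0 by simp
    have y3: "y ^ 3 < 1"
      using y y0 by (simp add: power_less_one_iff)
    have "(r has_real_derivative - (y ^ 2 / (1 - y ^ 3) powr (2 / 3))) (at y)"
    proof -
      have "(1 - y ^ 3) powr (1 / 3 - 1) = 1 / (1 - y ^ 3) powr (2 / 3)"
        using powr_minus_divide[of "1 - y ^ 3" "2 / 3"] by simp
      thus ?thesis
        unfolding r_def using y3
        by (auto intro!: derivative_eq_intros simp: field_simps)
    qed
    moreover have "(G has_real_derivative 1 / y ^ 2) (at (r y))"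
    proof -
      have "1 - r y ^ 3 = y ^ 3"
        using y3 by (simp add: r_def powr_power)
      moreover have "(y ^ 3) powr (2 / 3) = y ^ 2"
      proof -
        have "y ^ 3 = y powr 3" "y ^ 2 = y powr 2"
          using powr_realpow[of y 3] powr_realpow[of y 2] y_pos by simp_all
        thus ?thesis
          by (simp only: powr_powr) simp
      qed
      ultimately show ?thesis
        using G'[of "r y"] r_bounds[of y] y by simp
    qed
    ultimately have "((\<lambda>y. G (r y)) has_real_derivative
                       1 / y ^ 2 * (- (y ^ 2 / (1 - y ^ 3) powr (2 / 3)))) (at y)"
      by (rule DERIV_chain2[rotated])
    from DERIV_minus[OF this] have "((\<lambda>y. - G (r y)) has_real_derivative ?f y) (at y)"
      using y_pos by simp
    thus "((\<lambda>y. - G (r y)) has_vector_derivative ?f y) (at y)"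
      by (simp add: has_real_derivative_iff_has_vector_derivative)
  qed (use y0 in auto)
  moreover have "r 1 = 0" "r y0 = y0"
    unfolding r_def y0_cube by (simp_all add: y0_def)
  moreover have "G 0 = 0"
    by (simp add: G_def)
  ultimately have upper: "(?f has_integral G y0) {y0..1}"
    by simp
  have "(?f has_integral G y0) {0..y0}"
    unfolding G_def using y0 by (intro has_integral_dixon_int) auto
  from has_integral_combine[OF _ _ this upper] have "(?f has_integral 2 * G y0) {0..1}"
    using y0 by simp
  hence "G y0 = pi3 / 6"
    unfolding pi3_def by (simp add: integral_unique)
  hence "dixon_int (of_real y0) = of_real (pi3 / 6)"
    using dixon_int_of_real[OF y0] by (simp only: G_def)
  thus ?thesis
    by (simp only: y0_def)
qed

section \<open>The generating function of the pseudo-factorials\<close>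

definition pf_coeff :: "nat \<Rightarrow> complex" where
  "pf_coeff n = of_int (pseudo_factorial n) / fact n"

definition pf_egf :: "complex \<Rightarrow> complex" where
  "pf_egf z = (\<Sum>n. pf_coeff n * z ^ n)"

text \<open>
  Each of the \<open>m + 1\<close> terms of the recurrence for \<open>pseudo_factorial (Suc m)\<close> is, in absolute
  value, at most \<open>(m choose k) * fact k * fact (m - k) = fact m\<close>.
\<close>

lemma abs_pseudo_factorial_le: "\<bar>pseudo_factorial n\<bar> \<le> fact n"
proof (induction n rule: less_induct)
  case (less n)
  show ?case
  proof (cases n)
    case (Suc m)
    have "\<bar>pseudo_factorial n\<bar> =
            \<bar>\<Sum>k\<le>m. int (m choose k) * pseudo_factorial k * pseudo_factorial (m - k)\<bar>"
      by (simp only: Suc pseudo_factorial.simps abs_mult power_abs) simp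
    also have "\<dots> \<le> (\<Sum>k\<le>m. \<bar>int (m choose k) * pseudo_factorial k * pseudo_factorial (m - k)\<bar>)"
      by (rule sum_abs)
    also have "\<dots> \<le> (\<Sum>k\<le>m. fact m)"
    proof (rule sum_mono)
      fix k assume k: "k \<in> {..m}"
      have "\<bar>int (m choose k) * pseudo_factorial k * pseudo_factorial (m - k)\<bar> \<le>
              int (m choose k) * fact k * fact (m - k)"
        unfolding abs_mult using k Suc by (intro mult_mono less) auto
      also have "\<dots> = int (fact k * fact (m - k) * (m choose k))"
        by (simp add: mult_ac)
      also have "\<dots> = fact m"
        using k by (subst binomial_fact_lemma) auto
      finally show "\<bar>int (m choose k) * pseudo_factorial k * pseudo_factorial (m - k)\<bar> \<le> fact m" .
    qed
    also have "\<dots> = fact n"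
      by (simp add: Suc)
    finally show ?thesis .
  qed auto
qed

lemma norm_pf_coeff_le: "norm (pf_coeff n) \<le> 1"
proof -
  have "\<bar>real_of_int (pseudo_factorial n)\<bar> \<le> fact n"
    using abs_pseudo_factorial_le[of n] by (metis of_int_abs of_int_fact of_int_le_iff)
  thus ?thesis
    by (simp add: pf_coeff_def norm_divide)
qed

lemma pf_coeff_Suc:
  "of_nat (Suc n) * pf_coeff (Suc n) = (-1) ^ Suc n * (\<Sum>k\<le>n. pf_coeff k * pf_coeff (n - k))"
proof -
  have "of_nat (Suc n) * pf_coeff (Suc n) = of_int (pseudo_factorial (Suc n)) / fact n"
    by (simp add: pf_coeff_def del: pseudo_factorial.simps of_nat_Suc)
  also have "\<dots> = (-1) ^ Suc n * (\<Sum>k\<le>n. of_nat (n choose k) *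
                     of_int (pseudo_factorial k) * of_int (pseudo_factorial (n - k)) / fact n)"
    by (simp flip: sum_divide_distrib)
  also have "(\<Sum>k\<le>n. of_nat (n choose k) *
                of_int (pseudo_factorial k) * of_int (pseudo_factorial (n - k)) / fact n) =
             (\<Sum>k\<le>n. pf_coeff k * pf_coeff (n - k))"
    by (rule sum.cong) (auto simp: pf_coeff_def binomial_fact)
  finally show ?thesis .
qed

lemma summable_norm_pf_egf:
  assumes "norm z < 1"
  shows   "summable (\<lambda>n. norm (pf_coeff n * z ^ n))"
proof (rule summable_comparison_test')
  show "summable (\<lambda>n. norm z ^ n)"
    using assms by (intro summable_geometric) auto
  show "norm (norm (pf_coeff n * z ^ n)) \<le> norm z ^ n" if "n \<ge> 0" for n
    using norm_pf_coeff_le[of n] by (simp add: norm_mult norm_power mult_left_le_one_le)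
qed

lemma pf_egf_0 [simp]: "pf_egf 0 = 1"
  using powser_zero[of pf_coeff] by (simp add: pf_egf_def pf_coeff_def)

text \<open>
  The recurrence read as an identity of power series: its convolution is a Cauchy square, and its sign \<open>(-1) ^ n\<close>
  replaces \<open>z\<close> by \<open>- z\<close>.
\<close>

lemma has_field_derivative_pf_egf:
  assumes "norm z < 1"
  shows   "(pf_egf has_field_derivative - (pf_egf (-z) ^ 2)) (at z)"
proof -
  have "(pf_egf has_field_derivative (\<Sum>n. diffs pf_coeff n * z ^ n)) (at z)"
    unfolding pf_egf_def [abs_def]
    by (rule termdiffs_strong'[of 1]) (use assms summable_norm_pf_egf in \<open>auto intro: summable_norm_cancel\<close>)
  also have "(\<lambda>n. diffs pf_coeff n * z ^ n) =
               (\<lambda>n. - (\<Sum>k\<le>n. (pf_coeff k * (-z) ^ k) * (pf_coeff (n - k) * (-z) ^ (n - k))))"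
  proof
    fix n
    have "(\<Sum>k\<le>n. (pf_coeff k * (-z) ^ k) * (pf_coeff (n - k) * (-z) ^ (n - k))) =
            (\<Sum>k\<le>n. pf_coeff k * pf_coeff (n - k)) * (-z) ^ n"
      unfolding sum_distrib_right
      by (rule sum.cong) (auto simp: mult_ac simp flip: power_add)
    moreover have "(-z) ^ n = (-1) ^ n * z ^ n"
      by (simp flip: power_mult_distrib)
    ultimately show "diffs pf_coeff n * z ^ n =
        - (\<Sum>k\<le>n. (pf_coeff k * (-z) ^ k) * (pf_coeff (n - k) * (-z) ^ (n - k)))"
      by (simp only: diffs_def pf_coeff_Suc) simp
  qed
  also have "(\<Sum>n. - (\<Sum>k\<le>n. (pf_coeff k * (-z) ^ k) * (pf_coeff (n - k) * (-z) ^ (n - k)))) =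
               - (pf_egf (-z) ^ 2)"
    using Cauchy_product_sums[OF summable_norm_pf_egf summable_norm_pf_egf, of "-z" "-z"] assms
    by (intro sums_unique[symmetric] sums_minus) (simp add: pf_egf_def power2_eq_square)
  finally show ?thesis .
qed

lemma has_field_derivative_pf_egf_minus:
  assumes "norm z < 1"
  shows   "((\<lambda>z. pf_egf (-z)) has_field_derivative pf_egf z ^ 2) (at z)"
proof -
  have "((\<lambda>z. pf_egf (-z)) has_field_derivative - (pf_egf (- (-z)) ^ 2) * (-1)) (at z)"
    by (rule DERIV_chain2[OF has_field_derivative_pf_egf])
       (use assms in \<open>auto intro!: derivative_eq_intros\<close>)
  thus ?thesis
    by simp
qed

text \<open>
  The pair \<open>f (z)\<close>, \<open>g (z) = f (- z)\<close> solves \<open>f' = - g ^ 2\<close>, \<open>g' = f ^ 2\<close>, the system of sm and cm run backwards; the sum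
  of the cubes is its first integral.
\<close>

lemma pf_egf_cubes: "\<forall>\<^sub>F z in nhds 0. pf_egf z ^ 3 + pf_egf (-z) ^ 3 = 2"
proof -
  have "\<forall>\<^sub>F z::complex in nhds 0. z \<in> ball 0 1"
    by (rule eventually_nhds_in_open) auto
  hence "\<forall>\<^sub>F z in nhds 0. ((\<lambda>z. pf_egf z ^ 3 + pf_egf (-z) ^ 3) has_field_derivative 0) (at z)"
  proof eventually_elim
    case (elim z)
    show ?case
      using DERIV_add[OF DERIV_power[OF has_field_derivative_pf_egf, of z 3]
                         DERIV_power[OF has_field_derivative_pf_egf_minus, of z 3]] elim
      by (simp add: algebra_simps)
  qed
  from eventually_eq_const_of_deriv_zero[OF this] show ?thesis
    by simp
qed

text \<open>
  The point \<open>(f z / a, f (- z) / a)\<close> stays on the curve \<open>x ^ 3 + y ^ 3 = 1\<close>, and \<open>f' / a\<close> is \<open>- a\<close> times the square of its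
  second coordinate; so the integral decreases at the constant rate \<open>a\<close>.
\<close>

lemma dixon_int_pf_egf:
  defines "a \<equiv> complex_of_real (2 powr (1 / 3))"
  shows   "\<forall>\<^sub>F z in nhds 0. dixon_int (pf_egf z / a) = of_real (pi3 / 6) - a * z"
proof -
  have a3: "a ^ 3 = 2"
    by (simp add: a_def powr_power flip: of_real_power)
  have a_nz: "a \<noteq> 0"
    using a3 by auto
  have a_inv: "1 / a = of_real ((1 / 2) powr (1 / 3))"
    by (simp add: a_def powr_divide)
  have "norm (1 / a) ^ 3 < 1 ^ 3"
    using a3 by (simp add: norm_divide power_divide flip: norm_power)
  hence norm_inv: "norm (1 / a) < 1"
    by (rule power_less_imp_less_base) simp
  have lim_egf: "(pf_egf \<longlongrightarrow> 1) (nhds 0)"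
    using isCont_imp_tendsto_nhds[OF DERIV_isCont[OF has_field_derivative_pf_egf[of 0]]] by simp
  have lim_minus: "((\<lambda>z. pf_egf (-z)) \<longlongrightarrow> 1) (nhds 0)"
    using isCont_imp_tendsto_nhds[OF DERIV_isCont[OF has_field_derivative_pf_egf_minus[of 0]]] by simp
  have "\<forall>\<^sub>F z in nhds 0. norm (pf_egf z / a) < 1"
    by (rule order_tendstoD(2)[OF tendsto_norm[OF tendsto_divide[OF lim_egf tendsto_const a_nz]] norm_inv])
  moreover have "\<forall>\<^sub>F z in nhds 0. pf_egf (-z) \<noteq> 0"
    by (rule tendsto_imp_eventually_ne[OF lim_minus]) simp
  moreover have "\<forall>\<^sub>F z in nhds 0. ((pf_egf (-z) / a) ^ 3) powr (1 / 3) = pf_egf (-z) / a"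
    by (rule eventually_compose_filterlim[OF eventually_powr_third_power3[of "(1 / 2) powr (1 / 3)"]])
       (use tendsto_divide[OF lim_minus tendsto_const a_nz] in \<open>simp_all flip: a_inv\<close>)
  moreover note pf_egf_cubes
  moreover have "\<forall>\<^sub>F z::complex in nhds 0. z \<in> ball 0 1"
    by (rule eventually_nhds_in_open) auto
  ultimately have "\<forall>\<^sub>F z in nhds 0.
      ((\<lambda>z. dixon_int (pf_egf z / a) + a * z) has_field_derivative 0) (at z)"
  proof eventually_elim
    case (elim z)
    have "pf_egf (-z) ^ 3 = a ^ 3 - pf_egf z ^ 3"
      using elim(4) by (simp add: a3 algebra_simps)
    hence "1 - (pf_egf z / a) ^ 3 = (pf_egf (-z) / a) ^ 3"
      using a_nz by (simp add: power_divide diff_divide_distrib)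
    hence root: "dixon_root (pf_egf z / a) = pf_egf (-z) / a"
      using elim(3) by (simp add: dixon_root_def)
    have "((\<lambda>z. dixon_int (pf_egf z / a)) has_field_derivative
            1 / dixon_root (pf_egf z / a) ^ 2 * (- (pf_egf (-z) ^ 2) / a)) (at z)"
      using elim
      by (intro DERIV_chain2[OF has_field_derivative_dixon_int] DERIV_cdivide has_field_derivative_pf_egf) auto
    also have "1 / dixon_root (pf_egf z / a) ^ 2 * (- (pf_egf (-z) ^ 2) / a) = - a"
      unfolding root using elim(2) a_nz by (simp add: field_simps power2_eq_square)
    finally have "((\<lambda>z. dixon_int (pf_egf z / a)) has_field_derivative - a) (at z)" .
    from DERIV_add[OF this DERIV_cmult_Id[of a]] show ?case
      by simp
  qed
  from eventually_eq_const_of_deriv_zero[OF this]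
  have "\<forall>\<^sub>F z in nhds 0. dixon_int (pf_egf z / a) + a * z = of_real (pi3 / 6)"
    by (simp add: a_inv dixon_int_inverse_cbrt_2)
  thus ?thesis
    by eventually_elim (simp add: algebra_simps)
qed

theorem theorem1:
  "\<forall>\<^sub>F z :: complex in nhds 0.
     (\<lambda>n. of_int (pseudo_factorial n) * z ^ n / fact n) sums
       (of_real (2 powr (1 / 3)) *
          dixon_sm (of_real (pi3 / 6) - of_real (2 powr (1 / 3)) * z))"
proof -
  define a where "a = complex_of_real (2 powr (1 / 3))"
  have a_nz: "a \<noteq> 0"
    by (simp add: a_def)
  have "(2::real) powr (1 / 3) > 2 powr 0"
    by (intro powr_less_mono) auto
  hence "norm (pf_egf 0 / a) < 1"
    by (simp add: a_def norm_divide)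
  moreover have "((\<lambda>z. norm (pf_egf z / a)) \<longlongrightarrow> norm (pf_egf 0 / a)) (nhds 0)"
    using isCont_imp_tendsto_nhds[OF DERIV_isCont[OF has_field_derivative_pf_egf[of 0]]] a_nz
    by (intro tendsto_norm tendsto_divide tendsto_const) auto
  ultimately have "\<forall>\<^sub>F z in nhds 0. norm (pf_egf z / a) < 1"
    by (intro order_tendstoD(2))
  moreover have "\<forall>\<^sub>F z::complex in nhds 0. z \<in> ball 0 1"
    by (rule eventually_nhds_in_open) auto
  moreover have "\<forall>\<^sub>F z in nhds 0. dixon_int (pf_egf z / a) = of_real (pi3 / 6) - a * z"
    unfolding a_def by (rule dixon_int_pf_egf)
  ultimately show ?thesis
    unfolding a_def[symmetric]
  proof eventually_elim
    case (elim z)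
    have "a * dixon_sm (of_real (pi3 / 6) - a * z) = pf_egf z"
      using dixon_sm_dixon_int[OF elim(1)] elim(3) a_nz by simp
    moreover have "(\<lambda>n. pf_coeff n * z ^ n) sums pf_egf z"
      unfolding pf_egf_def using elim(2)
      by (intro summable_sums summable_norm_cancel[OF summable_norm_pf_egf]) auto
    ultimately show ?case
      by (simp only: pf_coeff_def times_divide_eq_left)
  qed
qed

end
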